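(* Let $N,M$ be positive integers, let $\mathcal A,\mathcal M\in\mathbb C^{N\times N}$ with $\mathcal A$ Hermitian positive semi-definite and $\mathcal M$ Hermitian positive definite, let $\mathcal B\in\mathbb C^{N\times M}$ satisfy $\mathcal A\mathcal M^{-1}\mathcal B=0$, let $\mathcal U\in\mathbb C^{M\times M}$ be Hermitian positive definite, let $c>0$ be real, and let $\mathcal F\in\mathbb C^N$. Suppose $\dim\mathbb C_0=0$. Then the constrained system $$(\mathcal A+c\mathcal M)u+\mathcal B p=\mathcal F,\qquad \mathcal B^* u=0\qquad (u\in\mathbb C^N,\ p\in\mathbb C^M)$$ has a solution $(u,p)$ whose component $u$ is unique, and this $u$ is obtained as follows: there is a unique $\tilde u\in\mathbb C^N$ with $$(\mathcal A+\mathcal B\mathcal U\mathcal B^* )\tilde u=\mathcal F,$$ and then $u$ is the unique solution in $\mathbb C^N$ of $$(\mathcal A+c\mathcal M)u=\mathcal F-\mathcal B\mathcal U\mathcal B^*\tilde u.$$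
   Context: $X^*$ denotes the conjugate transpose of a matrix $X$. $\mathbb C_0:=\operatorname{Ker}\mathcal A\cap\operatorname{Ker}(\mathcal B\mathcal U\mathcal B^* )\subset\mathbb C^N$. *)

theory Defs
  imports "HOL-Analysis.Analysis"
begin

text \<open>An \<open>m\<close> by \<open>n\<close> complex matrix (\<open>m\<close> rows, \<open>n\<close> columns) has type \<^typ>\<open>complex^'n^'m\<close>.\<close>

definition conj_transpose :: "complex^'n^'m \<Rightarrow> complex^'m^'n" where
  "conj_transpose X = (\<chi> i j. cnj (X $ j $ i))"

definition hermitian :: "complex^'n^'n \<Rightarrow> bool" where
  "hermitian X \<longleftrightarrow> conj_transpose X = X"

definition quad_form :: "complex^'n^'n \<Rightarrow> complex^'n \<Rightarrow> complex" where
  "quad_form X x = (\<Sum>i\<in>UNIV. cnj (x $ i) * (X *v x) $ i)"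

text \<open>For Hermitian \<open>X\<close> the number \<open>quad_form X x\<close> is real, so taking its real part below
  loses nothing.\<close>

definition hermitian_psd :: "complex^'n^'n \<Rightarrow> bool" where
  "hermitian_psd X \<longleftrightarrow> hermitian X \<and> (\<forall>x. 0 \<le> Re (quad_form X x))"

definition hermitian_pd :: "complex^'n^'n \<Rightarrow> bool" where
  "hermitian_pd X \<longleftrightarrow> hermitian X \<and> (\<forall>x. x \<noteq> 0 \<longrightarrow> 0 < Re (quad_form X x))"

definition Ker :: "complex^'n^'m \<Rightarrow> (complex^'n) set" where
  "Ker X = {x. X *v x = 0}"

definition C0 :: "complex^'n^'n \<Rightarrow> complex^'m^'n \<Rightarrow> complex^'m^'m \<Rightarrow> (complex^'n) set" where
  "C0 A B U = Ker A \<inter> Ker (B ** U ** conj_transpose B)"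

end

(* Write S = B U B*.  Both A + cM and A + S are injective, hence bijective: the quadratic form of the
   first is positive, and a null vector of the second is null for A and for S separately, so it lies
   in C0.  Let ut solve (A + S) ut = F and u solve (A + cM) u = F - S ut = A ut.  Then
   cM u = A (ut - u), so B* u = B* M^-1 A (ut - u) / c = (A M^-1 B)* (ut - u) / c = 0,
   and (u, U B* ut) solves the constrained system.  Uniqueness of u holds because the range of B is
   orthogonal to Ker B*. *)

theory Submission
  imports Defs
begin

text \<open>The Hermitian inner product, conjugate-linear in the first argument to match
  \<open>quad_form\<close>.\<close>

definition cdot :: "complex^'n \<Rightarrow> complex^'n \<Rightarrow> complex" where
  "cdot x y = (\<Sum>i\<in>UNIV. cnj (x $ i) * y $ i)"

lemma quad_form_eq_cdot: "quad_form X x = cdot x (X *v x)"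
  by (simp add: quad_form_def cdot_def)

lemma cdot_add_right: "cdot x (y + z) = cdot x y + cdot x z"
  by (simp add: cdot_def distrib_left sum.distrib)

lemma cdot_scaleR_right: "cdot x (c *\<^sub>R y) = complex_of_real c * cdot x y"
  by (simp add: cdot_def scaleR_sum_right flip: scaleR_conv_of_real)

lemma cdot_zero_left [simp]: "cdot 0 y = 0"
  and cdot_zero_right [simp]: "cdot x 0 = 0"
  by (simp_all add: cdot_def)

lemma cdot_self_eq_0_iff [simp]: "cdot x x = 0 \<longleftrightarrow> x = 0"
proof
  assume "cdot x x = 0"
  moreover have "cdot x x = complex_of_real (\<Sum>i\<in>UNIV. (cmod (x $ i))\<^sup>2)"
    by (simp add: cdot_def complex_norm_square[symmetric] mult.commute flip: of_real_power)
  ultimately have "(\<Sum>i\<in>UNIV. (cmod (x $ i))\<^sup>2) = 0"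
    by (simp only: of_real_eq_0_iff)
  then show "x = 0"
    by (subst (asm) sum_nonneg_eq_0_iff) (auto simp: vec_eq_iff)
qed simp

lemma cdot_adjoint: "cdot (conj_transpose X *v x) y = cdot x (X *v y)"
proof -
  have "cdot (conj_transpose X *v x) y = (\<Sum>j\<in>UNIV. \<Sum>i\<in>UNIV. X $ i $ j * cnj (x $ i) * y $ j)"
    by (simp add: cdot_def matrix_vector_mult_def conj_transpose_def sum_distrib_right)
  also have "\<dots> = (\<Sum>i\<in>UNIV. \<Sum>j\<in>UNIV. X $ i $ j * cnj (x $ i) * y $ j)"
    by (rule sum.swap)
  also have "\<dots> = cdot x (X *v y)"
    by (simp add: cdot_def matrix_vector_mult_def sum_distrib_left mult_ac)
  finally show ?thesis .
qed

lemma hermitian_cdot: "hermitian X \<Longrightarrow> cdot (X *v x) y = cdot x (X *v y)"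
  by (metis hermitian_def cdot_adjoint)

lemma scaleR_matrix_vector_mult: "(c *\<^sub>R X) *v x = c *\<^sub>R (X *v x)" for X :: "complex^'n^'m"
  by (simp add: vec_eq_iff matrix_vector_mult_def scaleR_sum_right)

lemma quad_form_add: "quad_form (X + Y) x = quad_form X x + quad_form Y x"
  by (simp add: quad_form_eq_cdot matrix_vector_mult_add_rdistrib cdot_add_right)

lemma quad_form_scaleR: "quad_form (c *\<^sub>R X) x = complex_of_real c * quad_form X x"
  by (simp add: quad_form_eq_cdot scaleR_matrix_vector_mult cdot_scaleR_right)

text \<open>Moving the left factor \<open>B\<close> across the inner product turns it into
  \<open>conj_transpose B\<close>; definiteness of \<open>U\<close> can then be applied to the
  vector \<open>conj_transpose B *v x\<close>.\<close>

lemma quad_form_congruence: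
  "quad_form (B ** U ** conj_transpose B) x = quad_form U (conj_transpose B *v x)"
  by (simp add: quad_form_eq_cdot cdot_adjoint flip: matrix_vector_mul_assoc)

lemma invertible_if_kernel_trivial:
  fixes X :: "complex^'n^'n"
  assumes "\<And>x. X *v x = 0 \<Longrightarrow> x = 0"
  shows "invertible X"
  using assms matrix_left_invertible_ker[of X] by (auto simp: invertible_left_inverse)

lemma invertible_ex1_solution:
  fixes X :: "complex^'n^'n"
  assumes "invertible X"
  shows "\<exists>!x. X *v x = y"
proof -
  obtain Y where "X ** Y = mat 1" "Y ** X = mat 1"
    using assms by (auto simp: invertible_def)
  then show ?thesis
    by (metis matrix_vector_mul_assoc matrix_vector_mul_lid)
qed

lemma hermitian_pd_invertible:
  assumes "hermitian_pd X"
  shows "invertible X"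
proof (rule invertible_if_kernel_trivial)
  fix x assume "X *v x = 0"
  then have "quad_form X x = 0"
    by (simp add: quad_form_eq_cdot)
  then show "x = 0"
    using assms unfolding hermitian_pd_def by force
qed

lemma quad_form_psd_plus_pd_pos:
  assumes "hermitian_psd A" "hermitian_pd M" "c > 0" "x \<noteq> 0"
  shows "0 < Re (quad_form (A + c *\<^sub>R M) x)"
  using assms
  by (simp add: quad_form_add quad_form_scaleR hermitian_psd_def hermitian_pd_def add_nonneg_pos)

text \<open>Pairing the equation with \<open>x\<close> gives two nonnegative real parts with sum
  zero, one from \<open>A\<close> and one from \<open>U\<close>.\<close>

lemma kernel_sum_congruence:
  assumes A: "hermitian_psd A" and U: "hermitian_pd U"
    and x: "(A + B ** U ** conj_transpose B) *v x = 0"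
  shows "x \<in> C0 A B U"
proof -
  let ?S = "B ** U ** conj_transpose B"
  have "quad_form (A + ?S) x = 0"
    using x by (simp add: quad_form_eq_cdot)
  then have sum: "Re (quad_form A x) + Re (quad_form U (conj_transpose B *v x)) = 0"
    by (metis quad_form_add quad_form_congruence plus_complex.sel(1) zero_complex.sel(1))
  have "0 \<le> Re (quad_form A x)"
    using A by (simp add: hermitian_psd_def)
  \<comment> \<open>Otherwise definiteness of \<open>U\<close> would make the sum strictly
    positive.\<close>
  with sum U have "conj_transpose B *v x = 0"
    unfolding hermitian_pd_def by (smt (verit))
  then have S: "?S *v x = 0"
    by (simp flip: matrix_vector_mul_assoc)
  with x have "A *v x = 0"
    by (simp add: matrix_vector_mult_add_rdistrib)
  with S show ?thesis
    by (simp add: C0_def Ker_def)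
qed

text \<open>For \<open>q = B* u\<close> and \<open>w = M^-1 B q\<close>, one has \<open>|q|^2 = <B
  q, u> = <M w, u> = <w, M u> = <w, A z> / c = <A w, z> / c\<close>, and \<open>A w = 0\<close> by
  the hypothesis on \<open>A M^-1 B\<close>.\<close>

lemma adjoint_constraint_automatic:
  fixes A M :: "complex^'n^'n" and B :: "complex^'m^'n"
  assumes A: "hermitian A" and M: "hermitian_pd M"
    and AMB: "A ** matrix_inv M ** B = 0" and c: "c > 0"
    and u: "c *\<^sub>R (M *v u) = A *v z"
  shows "conj_transpose B *v u = 0"
proof -
  define q where "q = conj_transpose B *v u"
  define w where "w = matrix_inv M *v (B *v q)"
  have "M ** matrix_inv M = mat 1"
    \<comment> \<open>\<open>matrix_inv\<close> is a Hilbert choice, so its inverse property is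
      drawn from the existence of an inverse.\<close>
    using hermitian_pd_invertible[OF M] unfolding invertible_def matrix_inv_def
    by (rule someI_ex[THEN conjunct1])
  then have Mw: "M *v w = B *v q"
    by (simp add: w_def matrix_vector_mul_assoc matrix_mul_assoc)
  have Aw: "A *v w = 0"
    using AMB by (simp add: w_def matrix_vector_mul_assoc matrix_mul_assoc)
  have "complex_of_real c * cdot w (M *v u) = cdot w (A *v z)"
    by (simp flip: u cdot_scaleR_right)
  also have "\<dots> = 0"
    using A Aw by (simp flip: hermitian_cdot)
  finally have "cdot w (M *v u) = 0"
    using c by simp
  then have "cdot (B *v q) u = 0"
    using M Mw by (metis hermitian_cdot hermitian_pd_def)
  moreover have "conj_transpose (conj_transpose B) = B"
    by (simp add: conj_transpose_def vec_eq_iff)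
  \<comment> \<open>With \<open>B\<close> read as the adjoint of \<open>B*\<close>, the vanishing
    product \<open><B q, u>\<close> becomes \<open><q, B* u> = <q, q>\<close>.\<close>
  ultimately have "cdot q q = 0"
    using cdot_adjoint[of "conj_transpose B" q u] by (simp add: q_def)
  then show ?thesis
    by (simp add: q_def)
qed

text \<open>The difference \<open>d = u - v\<close> satisfies \<open>X d + B (p - q) = 0\<close>.
  Pairing with \<open>d\<close> removes the second term because \<open>B* d = 0\<close>, leaving
  \<open>quad_form X d = 0\<close>. The multipliers \<open>p\<close> and \<open>q\<close> may
  differ.\<close>

lemma constrained_solution_unique:
  assumes pos: "\<And>x. x \<noteq> 0 \<Longrightarrow> 0 < Re (quad_form X x)"
    and "X *v u + B *v p = F" "conj_transpose B *v u = 0"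
    and "X *v v + B *v q = F" "conj_transpose B *v v = 0"
  shows "u = v"
proof -
  have B: "conj_transpose B *v (u - v) = 0"
    using assms by (simp add: matrix_vector_mult_diff_distrib)
  have "X *v (u - v) + B *v (p - q) = (X *v u + B *v p) - (X *v v + B *v q)"
    by (simp add: matrix_vector_mult_diff_distrib)
  also have "\<dots> = 0"
    using assms by simp
  finally have "cdot (u - v) (X *v (u - v)) + cdot (u - v) (B *v (p - q)) = 0"
    by (metis cdot_add_right cdot_zero_right)
  moreover have "cdot (u - v) (B *v (p - q)) = 0"
    by (metis B cdot_adjoint cdot_zero_left)
  ultimately have "quad_form X (u - v) = 0"
    by (simp add: quad_form_eq_cdot)
  then show ?thesis
    using pos[of "u - v"] by force
qed

theorem mainTheorem2:
  fixes A M :: "complex^'n^'n"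
    and B :: "complex^'m^'n"
    and U :: "complex^'m^'m"
    and c :: real
    and F :: "complex^'n"
  assumes "hermitian_psd A"
    and "hermitian_pd M"
    and "A ** matrix_inv M ** B = 0"
    and "hermitian_pd U"
    and "c > 0"
    and "vec.dim (C0 A B U) = 0"
  shows "(\<exists>!u. \<exists>p. (A + c *\<^sub>R M) *v u + B *v p = F \<and> conj_transpose B *v u = 0)
    \<and> (\<exists>!ut. (A + B ** U ** conj_transpose B) *v ut = F)
    \<and> (\<forall>u p ut.
         (A + c *\<^sub>R M) *v u + B *v p = F \<and> conj_transpose B *v u = 0 \<and>
         (A + B ** U ** conj_transpose B) *v ut = F \<longrightarrow>
         (A + c *\<^sub>R M) *v u = F - (B ** U ** conj_transpose B) *v ut \<and>
         (\<exists>!v. (A + c *\<^sub>R M) *v v = F - (B ** U ** conj_transpose B) *v ut))"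
proof -
  let ?K = "A + c *\<^sub>R M" and ?S = "B ** U ** conj_transpose B"
  note psd = assms(1) and pd = assms(2) and c = assms(5)
  have pos: "0 < Re (quad_form ?K x)" if "x \<noteq> 0" for x
    using quad_form_psd_plus_pd_pos[OF psd pd c that] .
  have K_ex1: "\<exists>!v. ?K *v v = y" for y
  proof (intro invertible_ex1_solution invertible_if_kernel_trivial)
    fix x assume "?K *v x = 0"
    then show "x = 0"
      using pos[of x] by (fastforce simp: quad_form_eq_cdot)
  qed
  have "C0 A B U \<subseteq> {0}"
    using assms(6) by simp
  then have T_ex1: "\<exists>!x. (A + ?S) *v x = F"
    using kernel_sum_congruence[OF psd assms(4)]
    by (intro invertible_ex1_solution invertible_if_kernel_trivial) blast
  have unique: "u = v"
    if "?K *v u + B *v p = F \<and> conj_transpose B *v u = 0"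
      and "?K *v v + B *v q = F \<and> conj_transpose B *v v = 0" for u v p q
    using constrained_solution_unique[of ?K u B p F v q] pos that by blast
  \<comment> \<open>The multiplier \<open>p = U B* ut\<close> is chosen so that
    \<open>B p = S ut\<close>, which makes the first equation a rearrangement of the one defining
    \<open>u\<close>.\<close>
  have construction: "?K *v u + B *v (U *v (conj_transpose B *v ut)) = F \<and> conj_transpose B *v u = 0"
    if ut: "(A + ?S) *v ut = F" and u: "?K *v u = F - ?S *v ut" for u ut
  proof
    \<comment> \<open>Expanding \<open>F\<close> as \<open>(A + S) ut\<close> cancels
      \<open>S ut\<close> on the right-hand side.\<close>
    have "A *v u + c *\<^sub>R (M *v u) = A *v ut"
      using u by (simp add: matrix_vector_mult_add_rdistrib scaleR_matrix_vector_mult flip: ut)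
    then have "c *\<^sub>R (M *v u) = A *v (ut - u)"
      by (simp add: matrix_vector_mult_diff_distrib algebra_simps)
    then show "conj_transpose B *v u = 0"
      using adjoint_constraint_automatic[OF _ pd assms(3) c] psd
      by (simp add: hermitian_psd_def)
    show "?K *v u + B *v (U *v (conj_transpose B *v ut)) = F"
      by (simp add: u matrix_vector_mul_assoc matrix_mul_assoc)
  qed
  show ?thesis
  proof (intro conjI allI impI)
    obtain ut where ut: "(A + ?S) *v ut = F"
      using T_ex1 by blast
    obtain u where "?K *v u = F - ?S *v ut"
      using K_ex1 by blast
    from construction[OF ut this]
    show "\<exists>!u. \<exists>p. ?K *v u + B *v p = F \<and> conj_transpose B *v u = 0"
      using unique by blast
  next
    fix u p ut
    assume h: "?K *v u + B *v p = F \<and> conj_transpose B *v u = 0 \<and> (A + ?S) *v ut = F"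
    obtain v where v: "?K *v v = F - ?S *v ut"
      using K_ex1 by blast
    \<comment> \<open>The constructed pair has \<open>v\<close> as its first component, so
      uniqueness identifies any constrained solution \<open>u\<close> with \<open>v\<close>,
      whatever its multiplier.\<close>
    have "u = v"
      using construction[OF _ v] h unique by blast
    with v show "?K *v u = F - ?S *v ut"
      by simp
  \<comment> \<open>What remains is unique solvability for \<open>A + S\<close> and for
    \<open>A + cM\<close>.\<close>
  qed (rule T_ex1 K_ex1)+
qed

end
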